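(* Let $n,m$ be relatively prime positive integers with $n<m$, let $\alpha=\frac{n}{m}$ (so $0<\alpha<1$), and let $F=\{0,\alpha,1\}\subseteq\mathbb{R}$. Then the following are equivalent: (i) There exists a Steinhaus set $S\subseteq\mathbb{R}$ for $F$ in $\mathbb{R}$. (ii) $\{n \bmod 3,\ m \bmod 3\}=\{1,2\}$. (iii) The set $S=\{3k : k\in\mathbb{Z}\}$ is a Steinhaus set for $\{0,n,m\}$ in $\mathbb{Z}$.
   Context: For $X\subseteq\mathbb{R}$, an isometric copy of $X$ in $\mathbb{R}$ is the image of $X$ under an isometry of $\mathbb{R}$ (a set $c+X$ or $c-X$ with $c\in\mathbb{R}$). A set $S\subseteq\mathbb{R}$ is a Steinhaus set for $X$ in $\mathbb{R}$ if $|Y\cap S|=1$ for every isometric copy $Y$ of $X$ in $\mathbb{R}$. For $X\subseteq\mathbb{Z}$, a set $S\subseteq\mathbb{Z}$ is a Steinhaus set for $X$ in $\mathbb{Z}$ if $|Y\cap S|=1$ for every isometric copy $Y$ of $X$ with $Y\subseteq\mathbb{Z}$. *)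

theory Defs
  imports Complex_Main
begin

text \<open>
  Surjectivity is not required: it is automatic for distance-preserving maps of the real line.
\<close>
definition isometry_real :: "(real \<Rightarrow> real) \<Rightarrow> bool" where
  "isometry_real f \<longleftrightarrow> (\<forall>x y. dist (f x) (f y) = dist x y)"

definition isometric_copy :: "real set \<Rightarrow> real set \<Rightarrow> bool" where
  "isometric_copy X Y \<longleftrightarrow> (\<exists>f. isometry_real f \<and> Y = f ` X)"

text \<open>
  The ambient set \<open>A\<close> is \<open>UNIV\<close> for Steinhaus sets in the reals and \<open>\<int>\<close>
  (as a subset of the reals) for Steinhaus sets in the integers.  An isometric copy is always the
  image under an isometry of the whole real line.
\<close>
definition steinhaus_set_in :: "real set \<Rightarrow> real set \<Rightarrow> real set \<Rightarrow> bool" where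
  "steinhaus_set_in A X S \<longleftrightarrow> X \<subseteq> A \<and> S \<subseteq> A \<and>
     (\<forall>Y. isometric_copy X Y \<and> Y \<subseteq> A \<longrightarrow> card (Y \<inter> S) = 1)"

end

theory Submission
  imports Defs
begin

text \<open>
  An isometry of the line is \<open>x \<mapsto> c + x\<close> or \<open>x \<mapsto> c - x\<close>.  Hence \<open>S\<close> is a Steinhaus set for
  \<open>{0, a, b}\<close> precisely when, for all admissible \<open>c\<close>, exactly one of the points
  \<open>c, c + a, c + b\<close> and exactly one of the points \<open>c, c - a, c - b\<close> lies in \<open>S\<close>
  (\<open>steinhaus_triple_iff\<close>).  After multiplication by \<open>m\<close> the problem becomes one about the
  integers and the triple \<open>{0, n, m}\<close>.

  Suppose that a Steinhaus set in the reals exists, and let \<open>\<chi>\<close> be the indicator function of its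
  trace on the multiples of \<open>1/m\<close>.  The triples \<open>{c, c + n, c + m}\<close> and \<open>{c, c + m - n, c + m}\<close>
  are both copies and share their end points, so \<open>\<chi> (c + n) = \<chi> (c + m - n)\<close>: thus \<open>m - 2 n\<close> is
  a period of \<open>\<chi>\<close>.  Modulo this period \<open>m\<close> is \<open>2 n\<close>, so
  \<open>\<chi> c + \<chi> (c + n) + \<chi> (c + 2 n) = 1\<close> for all \<open>c\<close>, and \<open>3 n\<close> is a period as well.
  If \<open>3\<close> did not divide \<open>m - 2 n\<close>, the two periods would be coprime and \<open>\<chi>\<close> would be constant,
  which is absurd since three equal integers cannot add up to \<open>1\<close>.  So \<open>3\<close> divides \<open>n + m\<close>
  (\<open>three_dvd_if_exact_cover\<close>), and by coprimality the residues of \<open>n\<close> and \<open>m\<close> are \<open>1\<close> and \<open>2\<close>.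

  Conversely, if the residues are \<open>1\<close> and \<open>2\<close>, the elements of every integer copy of \<open>{0, n, m}\<close>
  represent all classes modulo \<open>3\<close>, since a reflection only exchanges the residues
  \<open>1\<close> and \<open>2\<close> (\<open>three_dvd_exactly_one\<close>).  So the multiples of \<open>3\<close> form a Steinhaus set in the integers.
  They spread to the reals without any choice of coset representatives as
  \<open>{x. 3 dvd \<lfloor>m * x\<rfloor>}\<close>, because a shift of \<open>x\<close> by \<open>k/m\<close> shifts \<open>\<lfloor>m * x\<rfloor>\<close> by \<open>k\<close>.
\<close>

lemma isometry_real_iff:
  "isometry_real f \<longleftrightarrow> (\<exists>c. \<exists>s\<in>{1, -1}. f = (\<lambda>x. c + s * x))"
proof
  assume "isometry_real f"
  then have d: "\<bar>f x - f y\<bar> = \<bar>x - y\<bar>" for x y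
    by (simp add: isometry_real_def dist_real_def)
  \<comment> \<open>The image of \<open>1\<close> fixes the orientation; every other value is then determined by its
      distances from the images of \<open>0\<close> and \<open>1\<close>.\<close>
  consider "f 1 - f 0 = 1" | "f 1 - f 0 = -1"
    using d[of 1 0] by linarith
  then show "\<exists>c. \<exists>s\<in>{1, -1}. f = (\<lambda>x. c + s * x)"
  proof cases
    case 1
    have "f x = f 0 + 1 * x" for x
      using 1 d[of x 0] d[of x 1] by linarith
    then show ?thesis
      by blast
  next
    case 2
    have "f x = f 0 + (-1) * x" for x
      using 2 d[of x 0] d[of x 1] by linarith
    then show ?thesis
      by blast
  qed
qed (auto simp: isometry_real_def dist_real_def)

lemma card_triple_Int:
  assumes "x \<noteq> y" "x \<noteq> z" "y \<noteq> z"
  shows "card ({x, y, z} \<inter> S) = of_bool (x \<in> S) + of_bool (y \<in> S) + of_bool (z \<in> S)"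
  using assms by (auto simp: Int_insert_left)

lemma steinhaus_triple_iff:
  assumes "0 < a" "a < b"
  shows "steinhaus_set_in A {0, a, b} S \<longleftrightarrow> {0, a, b} \<subseteq> A \<and> S \<subseteq> A \<and>
    (\<forall>c. \<forall>s\<in>{1, -1}. {c, c + s * a, c + s * b} \<subseteq> A \<longrightarrow>
      of_bool (c \<in> S) + of_bool (c + s * a \<in> S) + of_bool (c + s * b \<in> S) = (1::nat))"
proof -
  let ?t = "\<lambda>c s. {c, c + s * a, c + s * b}"
  have copy_iff: "isometric_copy {0, a, b} Y \<longleftrightarrow> (\<exists>c. \<exists>s\<in>{1, -1}. Y = ?t c s)" for Y
    unfolding isometric_copy_def isometry_real_iff by fastforce
  have card_eq: "card (?t c s \<inter> S) =
      of_bool (c \<in> S) + of_bool (c + s * a \<in> S) + of_bool (c + s * b \<in> S)"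
    if "s \<in> {1, -1}" for c s
    using that assms by (intro card_triple_Int) auto
  have "(\<forall>Y. isometric_copy {0, a, b} Y \<and> Y \<subseteq> A \<longrightarrow> card (Y \<inter> S) = 1) \<longleftrightarrow>
      (\<forall>c. \<forall>s\<in>{1, -1}. ?t c s \<subseteq> A \<longrightarrow> card (?t c s \<inter> S) = 1)"
    unfolding copy_iff by blast
  also have "\<dots> \<longleftrightarrow> (\<forall>c. \<forall>s\<in>{1, -1}. ?t c s \<subseteq> A \<longrightarrow>
      of_bool (c \<in> S) + of_bool (c + s * a \<in> S) + of_bool (c + s * b \<in> S) = (1::nat))"
    by (intro iff_allI ball_cong refl imp_cong) (simp only: card_eq)
  finally show ?thesis
    unfolding steinhaus_set_in_def by (rule arg_cong)
qed

lemma int_period_mult: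
  fixes \<chi> :: "int \<Rightarrow> 'a"
  assumes "\<And>c. \<chi> (c + p) = \<chi> c"
  shows "\<chi> (c + k * p) = \<chi> c"
proof (induction k rule: int_induct[where k = 0])
  case (step1 i)
  then show ?case using assms[of "c + i * p"] by (simp add: algebra_simps)
next
  case (step2 i)
  then show ?case using assms[of "c + (i - 1) * p"] by (simp add: algebra_simps)
qed simp

lemma coprime_periods_imp_constant:
  fixes \<chi> :: "int \<Rightarrow> 'a"
  assumes "\<And>c. \<chi> (c + p) = \<chi> c" and "\<And>c. \<chi> (c + q) = \<chi> c" and "coprime p q"
  shows "\<chi> c = \<chi> 0"
proof -
  obtain u v where "u * p + v * q = 1"
    using \<open>coprime p q\<close> bezout_int[of p q] by auto
  then have "c = c * (u * p + v * q)"
    by simp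
  then have "c = 0 + (c * u) * p + (c * v) * q"
    by (simp only: distrib_left mult.assoc add_0)
  also have "\<chi> \<dots> = \<chi> (0 + (c * u) * p)"
    by (rule int_period_mult[of \<chi>, OF assms(2)])
  also have "\<dots> = \<chi> 0"
    by (rule int_period_mult[of \<chi>, OF assms(1)])
  finally show ?thesis .
qed

text \<open>
  The copies \<open>c + {0, n, m}\<close> and \<open>c + m - {0, n, m}\<close> have the same end points and so force the
  period \<open>m - 2 * n\<close>; this in turn forces the period \<open>3 * n\<close>.  A nonconstant function cannot
  have two coprime periods.
\<close>

lemma three_dvd_if_exact_cover:
  fixes \<chi> :: "int \<Rightarrow> nat" and n m :: int
  assumes up: "\<And>c. \<chi> c + \<chi> (c + n) + \<chi> (c + m) = 1"
    and down: "\<And>c. \<chi> c + \<chi> (c - n) + \<chi> (c - m) = 1"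
    and "coprime n m"
  shows "3 dvd n + m"
proof (rule ccontr)
  assume not_dvd: "\<not> 3 dvd n + m"
  have period_d: "\<chi> (c + (m - 2 * n)) = \<chi> c" for c
    using up[of "c - n"] down[of "c - n + m"] by (simp add: algebra_simps)
  have progression: "\<chi> c + \<chi> (c + n) + \<chi> (c + 2 * n) = 1" for c
    using up[of c] period_d[of "c + 2 * n"] by (simp add: algebra_simps)
  have period_3n: "\<chi> (c + 3 * n) = \<chi> c" for c
    using progression[of c] progression[of "c + n"] by (simp add: algebra_simps)
  have "coprime 3 (m - 2 * n)"
  proof -
    have "(m - 2 * n) mod 3 = 1 \<or> (m - 2 * n) mod 3 = 2"
      using not_dvd by presburger
    moreover have "coprime (3::int) 2"
      using coprime_add_one_left[of "2::int"] by simp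
    ultimately have "coprime 3 ((m - 2 * n) mod 3)"
      by (elim disjE) (simp_all only: coprime_1_right)
    then show ?thesis
      by simp
  qed
  moreover have "coprime n (m - 2 * n)"
    using \<open>coprime n m\<close> gcd_add_mult[of n "-2" m] by (simp add: coprime_iff_gcd_eq_1 algebra_simps)
  ultimately have "coprime (3 * n) (m - 2 * n)"
    by simp
  then have "\<chi> c = \<chi> 0" for c
    by (rule coprime_periods_imp_constant[of \<chi>, OF period_3n period_d])
  from this[of n] this[of m] show False
    using up[of 0] by simp presburger
qed

lemma residues_eq_1_2_iff:
  fixes n m :: nat
  assumes "coprime n m"
  shows "{n mod 3, m mod 3} = {1, 2} \<longleftrightarrow> 3 dvd n + m"
proof -
  have "\<not> (3 dvd n \<and> 3 dvd m)"
    using assms by (auto dest: coprime_common_divisor_nat)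
  then show ?thesis
    unfolding doubleton_eq_iff by presburger
qed

lemma of_bool_three_sum_eq_1_iff:
  "of_bool P + of_bool Q + of_bool R = (1::nat) \<longleftrightarrow>
    P \<and> \<not> Q \<and> \<not> R \<or> \<not> P \<and> Q \<and> \<not> R \<or> \<not> P \<and> \<not> Q \<and> R"
  by auto

lemma three_dvd_exactly_one:
  fixes a b c :: int
  assumes "{a mod 3, b mod 3} = {1, 2}"
  shows "of_bool (3 dvd c) + of_bool (3 dvd c + a) + of_bool (3 dvd c + b) = (1::nat)"
proof -
  define i j where "i = a div 3" and "j = b div 3"
  have "a = 3 * i + 1 \<and> b = 3 * j + 2 \<or> a = 3 * i + 2 \<and> b = 3 * j + 1"
    using assms unfolding doubleton_eq_iff i_def j_def by presburger
  then show ?thesis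
    unfolding of_bool_three_sum_eq_1_iff by (elim disjE conjE; hypsubst; presburger)
qed

lemma signed_residues_eq_1_2:
  fixes n m :: nat and s :: int
  assumes "{n mod 3, m mod 3} = {1, 2}" and "s \<in> {1, -1}"
  shows "{s * int n mod 3, s * int m mod 3} = {1, 2}"
proof -
  have "s = 1 \<or> s = -1"
    using assms(2) by simp
  then show ?thesis
    using assms(1) unfolding doubleton_eq_iff
    by (elim disjE; hypsubst; simp only: mult_1 mult_minus_left; presburger)
qed

theorem proposition2p1:
  fixes n m :: nat and \<alpha> :: real and F :: "real set"
  assumes "0 < n" and "0 < m" and "coprime n m" and "n < m"
    and "\<alpha> = real n / real m"
    and "F = {0, \<alpha>, 1}"
  shows "((\<exists>S. steinhaus_set_in UNIV F S) \<longleftrightarrow> {n mod 3, m mod 3} = {1, 2}) \<and>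
         ({n mod 3, m mod 3} = {1, 2} \<longleftrightarrow>
           steinhaus_set_in \<int> {0, real n, real m} {3 * real_of_int k |k. k \<in> UNIV})"
proof -
  let ?T = "{3 * real_of_int k |k. k \<in> UNIV}"
  have \<alpha>: "0 < \<alpha>" "\<alpha> < 1"
    using assms by auto
  have F_iff: "steinhaus_set_in UNIV F S \<longleftrightarrow> (\<forall>c. \<forall>s\<in>{1, -1}.
      of_bool (c \<in> S) + of_bool (c + s * \<alpha> \<in> S) + of_bool (c + s * 1 \<in> S) = (1::nat))" for S
    unfolding \<open>F = {0, \<alpha>, 1}\<close> using steinhaus_triple_iff[OF \<alpha>, of UNIV S] by simp
  have mem_T: "of_int z \<in> ?T \<longleftrightarrow> 3 dvd z" for z
  proof -
    have "of_int z = 3 * real_of_int k \<longleftrightarrow> z = 3 * k" for k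
      by linarith
    then show ?thesis
      by (auto simp: dvd_def)
  qed
  have "3 dvd n + m" if S: "steinhaus_set_in UNIV F S" for S
  proof -
    define \<chi> :: "int \<Rightarrow> nat" where "\<chi> c = of_bool (real_of_int c / real m \<in> S)" for c
    have up: "\<chi> c + \<chi> (c + int n) + \<chi> (c + int m) = 1" for c
      using S[unfolded F_iff, rule_format, of 1 "of_int c / real m"] assms
      by (simp add: \<chi>_def add_divide_distrib)
    have down: "\<chi> c + \<chi> (c - int n) + \<chi> (c - int m) = 1" for c
      using S[unfolded F_iff, rule_format, of "-1" "of_int c / real m"] assms
      by (simp add: \<chi>_def diff_divide_distrib)
    have "3 dvd int n + int m"
      using three_dvd_if_exact_cover[of \<chi>, OF up down] \<open>coprime n m\<close> by simp
    then show ?thesis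
      by presburger
  qed
  moreover have "steinhaus_set_in UNIV F {x. 3 dvd \<lfloor>real m * x\<rfloor>}"
    if res: "{n mod 3, m mod 3} = {1, 2}"
    unfolding F_iff
  proof (intro allI ballI)
    fix c s :: real
    assume "s \<in> {1, -1}"
    then obtain t :: int where t: "s = of_int t" "t \<in> {1, -1}"
      by force
    have "real m * (c + s * \<alpha>) = real m * c + of_int (t * int n)"
      "real m * (c + s * 1) = real m * c + of_int (t * int m)"
      using assms t by (auto simp: algebra_simps)
    then have "\<lfloor>real m * (c + s * \<alpha>)\<rfloor> = \<lfloor>real m * c\<rfloor> + t * int n"
      "\<lfloor>real m * (c + s * 1)\<rfloor> = \<lfloor>real m * c\<rfloor> + t * int m"
      by (simp_all only: floor_add_int)
    then show "of_bool (c \<in> {x. 3 dvd \<lfloor>real m * x\<rfloor>})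
        + of_bool (c + s * \<alpha> \<in> {x. 3 dvd \<lfloor>real m * x\<rfloor>})
        + of_bool (c + s * 1 \<in> {x. 3 dvd \<lfloor>real m * x\<rfloor>}) = (1::nat)"
      using three_dvd_exactly_one[OF signed_residues_eq_1_2[OF res t(2)], of "\<lfloor>real m * c\<rfloor>"] by (simp only: mem_Collect_eq)
  qed
  moreover have "steinhaus_set_in \<int> {0, real n, real m} ?T"
    if res: "{n mod 3, m mod 3} = {1, 2}"
  proof -
    have "of_bool (c \<in> ?T) + of_bool (c + s * real n \<in> ?T) + of_bool (c + s * real m \<in> ?T)
        = (1::nat)"
      if s: "s \<in> {1, -1}" and c: "{c, c + s * real n, c + s * real m} \<subseteq> \<int>" for c s
    proof -
      obtain t :: int where t: "s = of_int t" "t \<in> {1, -1}"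
        using s by force
      obtain z where z: "c = of_int z"
        using c by (auto elim: Ints_cases)
      have "c + s * real n = of_int (z + t * int n)" "c + s * real m = of_int (z + t * int m)"
        using t z by simp_all
      then show ?thesis
        using three_dvd_exactly_one[OF signed_residues_eq_1_2[OF res t(2)], of z] by (simp only: mem_T z)
    qed
    then show ?thesis
      using assms by (subst steinhaus_triple_iff) auto
  qed
  moreover have "{n mod 3, m mod 3} = {1, 2}"
    if T: "steinhaus_set_in \<int> {0, real n, real m} ?T"
  proof -
    have once: "of_bool (3 dvd z) + of_bool (3 dvd z + int n) + of_bool (3 dvd z + int m)
        = (1::nat)" for z
    proof -
      have "\<forall>c. \<forall>s\<in>{1, -1}. {c, c + s * real n, c + s * real m} \<subseteq> \<int> \<longrightarrow>
          of_bool (c \<in> ?T) + of_bool (c + s * real n \<in> ?T) + of_bool (c + s * real m \<in> ?T)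
            = (1::nat)"
        using T assms by (subst (asm) steinhaus_triple_iff) auto
      from this[rule_format, of 1 "of_int z"]
      show ?thesis
        using mem_T[of z] mem_T[of "z + int n"] mem_T[of "z + int m"] by simp
    qed
    \<comment> \<open>The copy at \<open>0\<close> excludes the residue \<open>0\<close>; the copy at \<open>1\<close> has exactly one of \<open>n\<close>, \<open>m\<close>
        in the class of \<open>2\<close>.\<close>
    show ?thesis
      using once[of 0] once[of 1]
      unfolding of_bool_three_sum_eq_1_iff doubleton_eq_iff by presburger
  qed
  ultimately show ?thesis
    using residues_eq_1_2_iff[OF \<open>coprime n m\<close>] by blast
qed

end
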